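(* For any $-1<\rho<0$ and $\gamma>1$, there exist a probability mass function $f$ on the non-negative integers, with finite positive mean $\mu$ and size-biased probability mass function $f^\ast(k)=kf(k)/\mu$, whose cumulative distribution function $F$ satisfies \[ 1-F(k)=\mathcal{L}(k)\,k^{-\gamma} \] for some slowly varying function $\mathcal{L}$, such that for any $\eta,\varepsilon>0$ and any sequence of graphs $G_n\in\mathcal{G}_{\eta,\varepsilon}(f,f^\ast)$, \[ \mathbb{P}\left(\widetilde{\rho}(G_n)>\rho\right)\ \ge\ 1-O\left(n^{-1+\kappa}+n^{-\varepsilon+3\kappa/4}+\mathbb{P}(\Omega_n^c)\right)\qquad(n\to\infty), \] where $\kappa=\min(\varepsilon,1/2)$.
   Context: Graphs are finite undirected multigraphs (self-loops and multiple edges allowed; a self-loop contributes 2 to the degree) and may be random. A degree sequence of length $n$ is a (possibly random) vector $\mathbf{D}_n=(D_1,\dots,D_n)$ of non-negative integers with even sum $L_n=\sum_{i=1}^n D_i$. Define $f_n(k)=\frac1n\sum_{i=1}^n \mathbf{1}\{D_i=k\}$ and $f_n^\ast(k)=\frac{1}{L_n}\sum_{i=1}^n k\,\mathbf{1}\{D_i=k\}$ (with $f_n^\ast\equiv 0$ if $L_n=0$), with cumulative functions $F_n(k)=\sum_{t\le k}f_n(t)$ and $F_n^\ast(k)=\sum_{t\le k}f_n^\ast(t)$ (vanishing at $-1$). For pmfs $f,f^\ast$ on $\{0,1,2,\dots\}$, with $F$ the cdf of $f$, and $\eta,\varepsilon>0$, write $G_n\in\mathcal{G}_{\eta,\varepsilon}(f,f^\ast)$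 if $G_n$ is a graph on $n$ nodes, with degree sequence $\mathbf{D}_n$, such that $\sum_{k\ge0}k^{1+\eta}f(k)<\infty$ and $\mathbb{P}(\Omega_n)\to1$, where \[ \Omega_n=\Big\{\max\Big\{\sum_{k=0}^\infty|F_n(k)-F(k)|,\ \sum_{k=0}^\infty|f_n^\ast(k)-f^\ast(k)|\Big\}\le n^{-\varepsilon}\Big\}. \] Each undirected edge $i-j$ is replaced by two directed edges $i\to j$ and $j\to i$ (so there are $L_n$ directed edges); $\sum_{i\to j\in G_n}$ is the sum over these. Put $\mathcal{F}_n^\ast(k)=F_n^\ast(k)+F_n^\ast(k-1)$ and \[ \widetilde{\rho}(G_n)=\frac{3}{L_n}\sum_{i\to j\in G_n}\mathcal{F}_n^\ast(D_i)\mathcal{F}_n^\ast(D_j)-3 . \] A function $\mathcal{L}$ is slowly varying if it is eventually positive and $\mathcal{L}(tx)/\mathcal{L}(x)\to1$ as $x\to\infty$ for every $t>0$. Constants in $O(\cdot)$ do not depend on $n$. *)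

theory Defs
  imports "HOL-Probability.Probability" "HOL-Library.Uprod" "HOL-Library.Landau_Symbols"
begin

section \<open>Finite undirected multigraphs\<close>

text \<open>
  A multigraph is the multiset of its edges; an edge is an unordered pair of nodes, which may
  coincide (\<open>Upair i i\<close> is a self-loop). The \<open>n\<close> nodes are \<open>0, \<dots>, n - 1\<close>.
\<close>

type_synonym multigraph = "nat uprod multiset"

definition multigraph_on :: "nat \<Rightarrow> multigraph \<Rightarrow> bool" where
  "multigraph_on n g \<longleftrightarrow> (\<forall>e\<in>#g. set_uprod e \<subseteq> {..<n})"

lift_definition endpoints :: "'a uprod \<Rightarrow> 'a multiset" is "\<lambda>(i, j). {#i, j#}"
  by (auto simp: add_mset_commute)

lift_definition orientations :: "'a uprod \<Rightarrow> ('a \<times> 'a) multiset"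
  is "\<lambda>(i, j). {#(i, j), (j, i)#}"
  by (auto simp: add_mset_commute)

lemma endpoints_Upair [simp]: "endpoints (Upair i j) = {#i, j#}"
  by transfer simp

lemma orientations_Upair [simp]: "orientations (Upair i j) = {#(i, j), (j, i)#}"
  by transfer simp

text \<open>A self-loop counts twice in the degree and yields two directed edges.\<close>

definition degree :: "multigraph \<Rightarrow> nat \<Rightarrow> nat" where
  "degree g i = (\<Sum>e\<in>#g. count (endpoints e) i)"

definition directed_edges :: "multigraph \<Rightarrow> (nat \<times> nat) multiset" where
  "directed_edges g = (\<Sum>e\<in>#g. orientations e)"

section \<open>Empirical degree distributions\<close>

text \<open>
  A degree sequence of length \<open>n\<close> is a function of which only the values at \<open>0, \<dots>, n - 1\<close> matter.
\<close>

definition deg_sum :: "nat \<Rightarrow> (nat \<Rightarrow> nat) \<Rightarrow> nat" where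
  "deg_sum n D = (\<Sum>i<n. D i)"

definition emp_pmf :: "nat \<Rightarrow> (nat \<Rightarrow> nat) \<Rightarrow> nat \<Rightarrow> real" where
  "emp_pmf n D k = (\<Sum>i<n. of_bool (D i = k)) / real n"

text \<open>If all degrees vanish this is \<open>0\<close>, by the convention \<open>x / 0 = 0\<close>.\<close>

definition emp_size_biased :: "nat \<Rightarrow> (nat \<Rightarrow> nat) \<Rightarrow> nat \<Rightarrow> real" where
  "emp_size_biased n D k = (\<Sum>i<n. real k * of_bool (D i = k)) / real (deg_sum n D)"

definition cumul :: "(nat \<Rightarrow> real) \<Rightarrow> nat \<Rightarrow> real" where
  "cumul p k = (\<Sum>t\<le>k. p t)"

lemma deg_sum_eq_size_directed_edges:
  assumes "multigraph_on n g"
  shows "deg_sum n (degree g) = size (directed_edges g)"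
  using assms
proof (induction g)
  case empty
  show ?case
    by (simp add: deg_sum_def degree_def directed_edges_def)
next
  case (add e g)
  obtain i j where e: "e = Upair i j"
    by (cases e)
  have "i < n" "j < n"
    using add.prems by (auto simp: multigraph_on_def e)
  then have "(\<Sum>k<n. count (endpoints e) k) = sum (count (endpoints e)) (set_mset (endpoints e))"
    by (intro sum.mono_neutral_right) (auto simp: e not_in_iff)
  also have "\<dots> = size (orientations e)"
    unfolding size_multiset_overloaded_eq [symmetric] by (simp add: e)
  finally have "(\<Sum>k<n. count (endpoints e) k) = size (orientations e)" .
  moreover have "deg_sum n (degree g) = size (directed_edges g)"
    using add.IH add.prems by (simp add: multigraph_on_def)
  ultimately show ?case
    by (simp add: deg_sum_def degree_def directed_edges_def sum.distrib)
qed

section \<open>Spearman's rho of a multigraph\<close>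

text \<open>\<open>F\<^sub>n\<^sup>*(k) + F\<^sub>n\<^sup>*(k - 1)\<close>, where the second term is the empty sum for \<open>k = 0\<close>.\<close>

definition emp_size_biased_sym :: "nat \<Rightarrow> (nat \<Rightarrow> nat) \<Rightarrow> nat \<Rightarrow> real" where
  "emp_size_biased_sym n D k =
     cumul (emp_size_biased n D) k + (\<Sum>t<k. emp_size_biased n D t)"

definition spearman_rho :: "nat \<Rightarrow> multigraph \<Rightarrow> real" where
  "spearman_rho n g =
     3 / real (deg_sum n (degree g)) *
       (\<Sum>(i, j)\<in>#directed_edges g.
          emp_size_biased_sym n (degree g) (degree g i) *
          emp_size_biased_sym n (degree g) (degree g j)) - 3"

section \<open>Graph sequences with regular degree sequences\<close>

text \<open>The sums are taken in \<^typ>\<open>ennreal\<close>, so that a divergent sum is infinite.\<close>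

definition Omega :: "real \<Rightarrow> nat pmf \<Rightarrow> nat pmf \<Rightarrow> nat \<Rightarrow> multigraph set" where
  "Omega \<epsilon> f f' n =
     {g. max (\<Sum>k. ennreal \<bar>cumul (emp_pmf n (degree g)) k - cumul (pmf f) k\<bar>)
             (\<Sum>k. ennreal \<bar>emp_size_biased n (degree g) k - pmf f' k\<bar>)
         \<le> ennreal (real n powr (-\<epsilon>))}"

text \<open>
  The random graph \<open>G\<^sub>n\<close> is represented by its distribution. There are only countably many
  multigraphs, so this covers all random multigraphs on arbitrary probability spaces.
\<close>

definition graph_class ::
    "real \<Rightarrow> real \<Rightarrow> nat pmf \<Rightarrow> nat pmf \<Rightarrow> (nat \<Rightarrow> multigraph pmf) set" where
  "graph_class \<eta> \<epsilon> f f' =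
     {G. (\<forall>n. \<forall>g\<in>set_pmf (G n). multigraph_on n g) \<and>
         summable (\<lambda>k. real k powr (1 + \<eta>) * pmf f k) \<and>
         (\<lambda>n. measure_pmf.prob (G n) (Omega \<epsilon> f f' n)) \<longlonglongrightarrow> 1}"

definition slowly_varying :: "(real \<Rightarrow> real) \<Rightarrow> bool" where
  "slowly_varying L \<longleftrightarrow>
     (\<forall>\<^sub>F x in at_top. L x > 0) \<and>
     (\<forall>t>0. ((\<lambda>x. L (t * x) / L x) \<longlongrightarrow> 1) at_top)"

end

theory Submission
  imports Defs
begin

text \<open>
  If almost all directed edges start at a node of degree \<open>1\<close>, then almost all edges join two such
  nodes, however the graph is wired, and there the summand of the rank correlation is close to
  \<open>1\<close>; so the correlation cannot be much below \<open>0\<close>. The tail \<open>1 - F(k) = c k\<^sup>-\<^sup>\<gamma>\<close> with a small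
  constant \<open>c\<close> has size-biased mass near \<open>1\<close> at \<open>k = 1\<close>, and on \<open>\<Omega>\<^sub>n\<close> the empirical size-biased
  mass at \<open>1\<close> is close to it. Hence for large \<open>n\<close> the bound holds on all of \<open>\<Omega>\<^sub>n\<close>, and the
  failure probability is at most \<open>P(\<Omega>\<^sub>n\<^sup>c)\<close>.
\<close>

section \<open>Lower bound for Spearman's rho\<close>

text \<open>A node \<open>i\<close> is the tail of exactly \<open>degree g i\<close> directed edges,
  a self-loop giving two of them, and by symmetry the head of equally many. In the induction, a new
  edge raises all three counts by the number of its ends that satisfy \<open>P\<close>.\<close>

lemma size_filter_directed_edges:
  assumes "multigraph_on n g"
  shows "size (filter_mset (\<lambda>(i, j). P i) (directed_edges g)) = (\<Sum>i | i < n \<and> P i. degree g i)"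
      (is "?fst g = ?deg g")
    and "size (filter_mset (\<lambda>(i, j). P j) (directed_edges g)) = (\<Sum>i | i < n \<and> P i. degree g i)"
      (is "?snd g = ?deg g")
proof -
  have "?fst g = ?deg g \<and> ?snd g = ?deg g"
    using assms
  proof (induction g)
    case empty
    show ?case
      by (simp add: degree_def directed_edges_def)
  next
    case (add e g)
    obtain i j where e: "e = Upair i j"
      by (cases e)
    have ij: "i < n" "j < n" and g: "multigraph_on n g"
      using add.prems by (auto simp: multigraph_on_def e)
    have "count (endpoints e) k = of_bool (k = i) + of_bool (k = j)" for k
      by (simp add: e)
    moreover have "(\<Sum>k | k < n \<and> P k. of_bool (k = l)) = (of_bool (P l) :: nat)" if "l < n" for l
      using that by (simp add: of_bool_def)
    ultimately have "(\<Sum>k | k < n \<and> P k. count (endpoints e) k) = of_bool (P i) + of_bool (P j)"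
      using ij by (simp only: sum.distrib)
    then have "?deg (add_mset e g) = of_bool (P i) + of_bool (P j) + ?deg g"
      by (simp add: degree_def sum.distrib)
    then show ?case
      using add.IH[OF g] by (simp add: directed_edges_def e)
  qed
  then show "?fst g = ?deg g" and "?snd g = ?deg g"
    by simp_all
qed

lemma emp_size_biased_0: "emp_size_biased n D 0 = 0"
  by (simp add: emp_size_biased_def)

lemma emp_size_biased_nonneg: "0 \<le> emp_size_biased n D k"
  by (simp add: emp_size_biased_def sum_nonneg)

lemma emp_size_biased_sym_nonneg: "0 \<le> emp_size_biased_sym n D k"
  by (simp add: emp_size_biased_sym_def cumul_def sum_nonneg emp_size_biased_nonneg)

lemma emp_size_biased_sym_1: "emp_size_biased_sym n D 1 = emp_size_biased n D 1"
  by (simp add: emp_size_biased_sym_def cumul_def emp_size_biased_0)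

lemma sum_mset_mono_subset:
  fixes h :: "'a \<Rightarrow> 'b :: ordered_comm_monoid_add"
  assumes "\<And>x. 0 \<le> h x"
  shows "(\<Sum>x\<in>#filter_mset P M. h x) \<le> (\<Sum>x\<in>#M. h x)"
  by (induction M) (auto intro: add_mono add_increasing assms)

text \<open>A share \<open>p\<close> of the directed edges leaves a degree-1 node and a share
  \<open>p\<close> enters one, so a share of at least \<open>2 * p - 1\<close> joins two such nodes.
  Each of these contributes \<open>p\<^sup>2\<close>, since size-biased mass at 0 vanishes; the
  other summands are nonnegative.\<close>

lemma spearman_rho_ge:
  assumes g: "multigraph_on n g" and L: "0 < deg_sum n (degree g)"
    and p: "p = emp_size_biased n (degree g) 1"
  shows "3 * p\<^sup>2 * (2 * p - 1) - 3 \<le> spearman_rho n g"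
proof -
  define D where "D = degree g"
  define E where "E = directed_edges g"
  define L where "L = real (deg_sum n D)"
  define X where "X = emp_size_biased_sym n D"
  have L0: "0 < L"
    using L by (simp add: L_def D_def)
  have X1: "X 1 = p" and X0: "0 \<le> X k" for k
    by (simp_all only: X_def emp_size_biased_sym_1 p D_def emp_size_biased_sym_nonneg)
  have sizeE: "real (size E) = L"
    by (simp add: E_def L_def D_def deg_sum_eq_size_directed_edges g)
  have "(\<Sum>i | i < n \<and> D i = 1. D i) = (\<Sum>i<n. of_bool (D i = 1))"
    by (intro sum.mono_neutral_cong_left) auto
  then have N: "real (\<Sum>i | i < n \<and> D i = 1. D i) = p * L"
    using L0 by (simp add: p emp_size_biased_def D_def L_def)
  have 1: "real (size (filter_mset (\<lambda>(i, j). D i = 1) E)) = p * L"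
    "real (size (filter_mset (\<lambda>(i, j). D j = 1) E)) = p * L"
    using size_filter_directed_edges[OF g, of "\<lambda>i. D i = 1"] N unfolding E_def D_def by simp_all
  define B where "B = filter_mset (\<lambda>(i, j). D i = 1 \<and> D j = 1) E"
  \<comment> \<open>Inclusion-exclusion for the directed edges whose tail, respectively head, has
    degree 1.\<close>
  have "size (filter_mset (\<lambda>(i, j). D i = 1) M) + size (filter_mset (\<lambda>(i, j). D j = 1) M)
      \<le> size M + size (filter_mset (\<lambda>(i, j). D i = 1 \<and> D j = 1) M)" for M :: "(nat \<times> nat) multiset"
    by (induction M) auto
  from this[of E] have B: "(2 * p - 1) * L \<le> real (size B)"
    using 1 sizeE unfolding B_def by (simp add: algebra_simps)
  have "p\<^sup>2 * ((2 * p - 1) * L) \<le> p\<^sup>2 * real (size B)"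
    by (intro mult_left_mono B) simp
  also have "\<dots> = (\<Sum>(i, j)\<in>#B. p\<^sup>2)"
    by (simp add: case_prod_unfold)
  also have "\<dots> = (\<Sum>(i, j)\<in>#B. X (D i) * X (D j))"
    using X1 by (intro arg_cong[of _ _ sum_mset] image_mset_cong)
      (auto simp: B_def power2_eq_square)
  also have "\<dots> \<le> (\<Sum>(i, j)\<in>#E. X (D i) * X (D j))"
    unfolding B_def by (rule sum_mset_mono_subset) (auto simp: X0)
  finally have "p\<^sup>2 * (2 * p - 1) \<le> (\<Sum>(i, j)\<in>#E. X (D i) * X (D j)) / L"
    using L0 by (simp add: field_simps)
  then show ?thesis
    unfolding spearman_rho_def E_def X_def L_def D_def by simp
qed

text \<open>Both \<open>p\<^sup>2\<close> and \<open>2 * p - 1\<close> exceed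
  \<open>1 - 2 * s\<close> here, and the product of these bounds is at least
  \<open>1 - 4 * s\<close>; the factor 3 turns the loss \<open>4 * s\<close> into
  \<open>12 * s\<close>.\<close>

lemma spearman_rho_gt:
  assumes g: "multigraph_on n g" and "0 < s" "s < 1 / 12"
    and p: "1 - s < emp_size_biased n (degree g) 1"
  shows "- 12 * s < spearman_rho n g"
proof (rule less_le_trans)
  define q where "q = emp_size_biased n (degree g) 1"
  have q: "1 - s < q"
    using p by (simp add: q_def)
  \<comment> \<open>With degree sum 0 the mass at 1 would be 0 by \<open>x / 0 = 0\<close>,
    contradicting \<open>p\<close>.\<close>
  have L: "0 < deg_sum n (degree g)"
    using p assms(3) by (cases "deg_sum n (degree g) = 0") (auto simp: emp_size_biased_def)
  have "2 * q - 1 \<le> q\<^sup>2"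
    using zero_le_power2[of "q - 1"] by (simp add: power2_diff)
  then have "(1 - 2 * s) * (1 - 2 * s) < q\<^sup>2 * (2 * q - 1)"
    using q assms by (intro mult_le_less_imp_less) auto
  moreover have "1 - 4 * s \<le> (1 - 2 * s) * (1 - 2 * s)"
    by (simp add: algebra_simps)
  ultimately show "- 12 * s < 3 * q\<^sup>2 * (2 * q - 1) - 3"
    by simp
  show "3 * q\<^sup>2 * (2 * q - 1) - 3 \<le> spearman_rho n g"
    using spearman_rho_ge[OF g L] by (simp add: q_def)
qed

lemma Omega_emp_size_biased:
  assumes "g \<in> Omega \<epsilon> f f' n"
  shows "\<bar>emp_size_biased n (degree g) k - pmf f' k\<bar> \<le> real n powr - \<epsilon>"
proof -
  define d where "d k = ennreal \<bar>emp_size_biased n (degree g) k - pmf f' k\<bar>" for k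
  have "d k \<le> (\<Sum>k. d k)"
    using sum_le_suminf[of d "{k}"] by simp
  also have "\<dots> \<le> ennreal (real n powr - \<epsilon>)"
    using assms by (simp add: Omega_def d_def)
  finally show ?thesis
    by (simp add: d_def)
qed

section \<open>Distributions on the natural numbers\<close>

text \<open>The masses are the decrements of \<open>T\<close>, so their partial sums telescope.
  Summability forces \<open>T\<close> to tend to 0, which gives total mass 1, and it makes the mean
  finite.\<close>

lemma pmf_with_tail_exists:
  fixes T :: "nat \<Rightarrow> real"
  assumes "antimono T" and "T 0 \<le> 1" and "summable T"
  obtains f :: "nat pmf" where
    "\<And>k. 1 - cumul (pmf f) k = T k"
    "integrable (measure_pmf f) real"
    "measure_pmf.expectation f real = suminf T"
proof -
  define u where "u k = (case k of 0 \<Rightarrow> 1 - T 0 | Suc k \<Rightarrow> T k - T (Suc k))" for k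
  have u0: "0 \<le> u k" for k
    using assms(1,2) by (auto simp: u_def antimono_iff_le_Suc split: nat.split)
  have u_sum: "(\<Sum>t\<le>k. u t) = 1 - T k" for k
    by (induction k) (simp_all add: u_def)
  have T_lim: "T \<longlonglongrightarrow> 0"
    using assms(3) by (rule summable_LIMSEQ_zero)
  have T0: "0 \<le> T k" for k
    using assms(1) T_lim by (rule decseq_ge)
  have "u sums 1"
    unfolding sums_def_le u_sum using tendsto_diff[OF tendsto_const[of 1] T_lim] by simp
  then have int_u: "(\<integral>\<^sup>+ k. ennreal (u k) \<partial>count_space UNIV) = 1"
    using u0 by (simp add: nn_integral_count_space_nat suminf_ennreal_eq[of u 1] sums_unique[symmetric])
  define f where "f = embed_pmf u"
  have pmf_f: "pmf f k = u k" for k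
    unfolding f_def using u0 int_u by (rule pmf_embed_pmf)
  have tail: "1 - cumul (pmf f) k = T k" for k
    by (simp add: cumul_def pmf_f u_sum)
  have "emeasure (measure_pmf f) {x. k < x} = ennreal (T k)" for k
  proof -
    have "measure (measure_pmf f) {..k} = 1 - T k"
      by (simp add: measure_measure_pmf_finite pmf_f u_sum)
    moreover have "{x. k < x} = space (measure_pmf f) - {..k}"
      by auto
    ultimately have "measure (measure_pmf f) {x. k < x} = T k"
      using measure_pmf.prob_compl[of "{..k}" f] by simp
    then show ?thesis
      by (simp add: measure_pmf.emeasure_eq_measure)
  qed
  \<comment> \<open>The mean of a variable on the naturals is the sum over \<open>k\<close> of the
    probabilities of exceeding \<open>k\<close>.\<close>
  then have "(\<integral>\<^sup>+ x. ennreal (real x) \<partial>measure_pmf f) = (\<Sum>k. ennreal (T k))"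
    using nn_integral_nat_function[of "\<lambda>x. x" "measure_pmf f"] by (simp add: ennreal_of_nat_eq_real_of_nat)
  also have "\<dots> = ennreal (suminf T)"
    using T0 assms(3) by (simp add: suminf_ennreal2)
  finally have E: "(\<integral>\<^sup>+ x. ennreal (real x) \<partial>measure_pmf f) = ennreal (suminf T)" .
  have "integrable (measure_pmf f) real"
    by (rule integrableI_nonneg) (simp_all add: E)
  moreover have "measure_pmf.expectation f real = suminf T"
    using E T0 assms(3) by (intro integral_eq_nn_integral[THEN trans]) (auto simp: suminf_nonneg)
  ultimately show thesis
    using that tail by blast
qed

lemma size_biased_pmf_exists:
  fixes f :: "nat pmf"
  assumes int: "integrable (measure_pmf f) real" and pos: "0 < measure_pmf.expectation f real"
  obtains f' :: "nat pmf" where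
    "\<And>k. pmf f' k = real k * pmf f k / measure_pmf.expectation f real"
proof
  define \<mu> where "\<mu> = measure_pmf.expectation f real"
  have "(\<integral>\<^sup>+ k. ennreal (real k * pmf f k / \<mu>) \<partial>count_space UNIV)
      = (\<integral>\<^sup>+ k. ennreal (real k / \<mu>) \<partial>measure_pmf f)"
    using pos by (simp add: nn_integral_measure_pmf ennreal_mult'' [symmetric] \<mu>_def ac_simps)
  also have "\<dots> = ennreal (measure_pmf.expectation f (\<lambda>k. real k / \<mu>))"
    using int pos by (intro nn_integral_eq_integral) (auto simp: \<mu>_def)
  also have "\<dots> = 1"
    using pos by (simp add: \<mu>_def)
  finally show "pmf (embed_pmf (\<lambda>k. real k * pmf f k / \<mu>)) k =
      real k * pmf f k / measure_pmf.expectation f real" for k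
    using pos by (subst pmf_embed_pmf) (auto simp: \<mu>_def)
qed

lemma zeta_tail_pmf_exists:
  fixes \<gamma> c :: real
  assumes "1 < \<gamma>" and "0 \<le> c" and "c \<le> 1"
  obtains f :: "nat pmf" where
    "\<And>k. 1 \<le> k \<Longrightarrow> 1 - cumul (pmf f) k = c * real k powr - \<gamma>"
    "pmf f 1 = 1 - c"
    "integrable (measure_pmf f) real"
    "measure_pmf.expectation f real = 1 + c * (\<Sum>k. real k powr - \<gamma>)"
proof -
  \<comment> \<open>Since \<open>0 powr - \<gamma>\<close> is 0, this gives \<open>T 0 = 1\<close>:
    there is no mass at 0, and the mass at 1 is \<open>T 0 - T 1 = 1 - c\<close>.\<close>
  define T where "T k = of_bool (k = 0) + c * real k powr - \<gamma>" for k :: nat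
  have Z: "summable (\<lambda>k. c * real k powr - \<gamma>)"
    using assms by (intro summable_mult) (simp add: summable_real_powr_iff)
  have one: "(\<lambda>k::nat. of_bool (k = 0) :: real) sums 1"
    using sums_single[of 0 "\<lambda>_. 1 :: real"] by (simp add: of_bool_def)
  have T: "T sums (1 + (\<Sum>k. c * real k powr - \<gamma>))"
    unfolding T_def using one Z[THEN summable_sums] by (rule sums_add)
  \<comment> \<open>At \<open>k = 0\<close> this is the assumption \<open>c \<le> 1\<close>; beyond
    that the power decreases.\<close>
  have "T (Suc k) \<le> T k" for k
    using assms by (cases "k = 0") (auto simp: T_def intro!: mult_left_mono powr_mono2')
  then have "antimono T"
    by (simp add: antimono_iff_le_Suc)
  moreover have "T 0 \<le> 1"
    by (simp add: T_def)
  moreover note sums_summable[OF T]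
  ultimately obtain f :: "nat pmf" where f: "\<And>k. 1 - cumul (pmf f) k = T k"
    "integrable (measure_pmf f) real" "measure_pmf.expectation f real = suminf T"
    by (rule pmf_with_tail_exists) blast
  show thesis
  proof (rule that[of f])
    show "1 - cumul (pmf f) k = c * real k powr - \<gamma>" if "1 \<le> k" for k
      using f(1)[of k] that by (simp add: T_def)
    show "pmf f 1 = 1 - c"
      using f(1)[of 0] f(1)[of 1] by (simp add: T_def cumul_def)
    show "measure_pmf.expectation f real = 1 + c * (\<Sum>k. real k powr - \<gamma>)"
      using sums_unique[OF T] f(3) assms by (simp add: suminf_mult summable_real_powr_iff)
  qed (rule f(2))
qed

section \<open>Choice of the tail constant and the probability bound\<close>

lemma slowly_varying_const: "0 < c \<Longrightarrow> slowly_varying (\<lambda>_. c)"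
  by (simp add: slowly_varying_def)

theorem corollary2p3:
  fixes \<rho> \<gamma> :: real
  assumes "-1 < \<rho>" and "\<rho> < 0" and "1 < \<gamma>"
  shows "\<exists>(f :: nat pmf) (f' :: nat pmf) (\<mu> :: real) (L :: real \<Rightarrow> real).
    integrable (measure_pmf f) real \<and>
    \<mu> = measure_pmf.expectation f real \<and> 0 < \<mu> \<and>
    (\<forall>k. pmf f' k = real k * pmf f k / \<mu>) \<and>
    slowly_varying L \<and>
    (\<forall>k\<ge>1. 1 - cumul (pmf f) k = L (real k) * real k powr (-\<gamma>)) \<and>
    (\<forall>(\<eta> :: real) (\<epsilon> :: real) (G :: nat \<Rightarrow> multigraph pmf).
      0 < \<eta> \<longrightarrow> 0 < \<epsilon> \<longrightarrow> G \<in> graph_class \<eta> \<epsilon> f f' \<longrightarrow>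
      (let \<kappa> = min \<epsilon> (1 / 2) in
       \<exists>h \<in> O(\<lambda>n. real n powr (-1 + \<kappa>) + real n powr (-\<epsilon> + 3 * \<kappa> / 4)
                    + measure_pmf.prob (G n) (- Omega \<epsilon> f f' n)).
         \<forall>\<^sub>F n in sequentially.
           measure_pmf.prob (G n) {g. spearman_rho n g > \<rho>} \<ge> 1 - h n))"
proof -
  define Z where "Z = (\<Sum>k. real k powr - \<gamma>)"
  \<comment> \<open>With this \<open>s\<close>, the bound \<open>- 12 * s\<close> is exactly
    \<open>\<rho>\<close>. The constant \<open>c\<close> is chosen so that the size-biased mass at
    1, which is \<open>(1 - c) / (1 + c * Z)\<close>, falls short of 1 by at most
    \<open>s / 2\<close>; the other \<open>s / 2\<close> absorbs the empirical error.\<close>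
  define s where "s = - \<rho> / 12"
  define c where "c = s / 2 / (1 + Z)"
  have s: "0 < s" "s < 1 / 12"
    using assms by (auto simp: s_def)
  have Z: "0 \<le> Z"
    unfolding Z_def using assms by (intro suminf_nonneg) (auto simp: summable_real_powr_iff)
  have cZ: "c * (1 + Z) = s / 2"
    using c_def Z by (subst (asm) nonzero_eq_divide_eq) simp_all
  have c: "0 < c" "c < 1"
    using s Z by (simp_all add: c_def divide_less_eq)
  obtain f :: "nat pmf" where
    f_tail: "\<And>k. 1 \<le> k \<Longrightarrow> 1 - cumul (pmf f) k = c * real k powr - \<gamma>" and
    f_1: "pmf f 1 = 1 - c" and
    f_int: "integrable (measure_pmf f) real" and
    f_mean: "measure_pmf.expectation f real = 1 + c * Z"
    using zeta_tail_pmf_exists[of \<gamma> c] assms(3) c unfolding Z_def by auto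
  define \<mu> where "\<mu> = measure_pmf.expectation f real"
  have \<mu>: "0 < \<mu>" "\<mu> = 1 + c * Z"
    using c Z by (simp_all add: \<mu>_def f_mean add_pos_nonneg)
  obtain f' :: "nat pmf" where f': "\<And>k. pmf f' k = real k * pmf f k / \<mu>"
    using size_biased_pmf_exists[OF f_int] \<mu> unfolding \<mu>_def by auto
  have "(1 - s / 2) * \<mu> = 1 - c - s / 2 * (c * Z)"
    using cZ unfolding \<mu>(2) by (simp add: algebra_simps)
  also have "\<dots> \<le> 1 - c"
    using s c Z by simp
  finally have f'_1: "1 - s / 2 \<le> pmf f' 1"
    using \<mu>(1) by (simp add: f' f_1[simplified] pos_le_divide_eq)
  \<comment> \<open>Once \<open>n\<close> is so large that the error bound defining
    \<open>Omega\<close> is below \<open>s / 2\<close>, every possible graph in \<open>Omega\<close>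
    has correlation above \<open>\<rho>\<close>.\<close>
  have main: "\<forall>\<^sub>F n in sequentially. measure_pmf.prob (G n) {g. spearman_rho n g > \<rho>}
      \<ge> 1 - measure_pmf.prob (G n) (- Omega \<epsilon> f f' n)"
    if "0 < \<epsilon>" and G: "G \<in> graph_class \<eta> \<epsilon> f f'" for \<eta> \<epsilon> G
  proof -
    have "(\<lambda>n. real n powr - \<epsilon>) \<longlonglongrightarrow> 0"
      using \<open>0 < \<epsilon>\<close> by (intro tendsto_neg_powr filterlim_real_sequentially) auto
    then have "\<forall>\<^sub>F n in sequentially. real n powr - \<epsilon> < s / 2"
      using s by (intro order_tendstoD(2)[of _ 0]) auto
    then show ?thesis
    proof eventually_elim
      case (elim n)
      have *: "\<rho> < spearman_rho n g" if "g \<in> set_pmf (G n)" "g \<in> Omega \<epsilon> f f' n" for g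
      proof -
        have "1 - s < emp_size_biased n (degree g) 1"
          using Omega_emp_size_biased[OF that(2), of 1] elim f'_1 by linarith
        moreover have "multigraph_on n g"
          using G that by (simp add: graph_class_def)
        ultimately show ?thesis
          using spearman_rho_gt[of n g s] s by (simp add: s_def)
      qed
      have "1 - measure_pmf.prob (G n) (- Omega \<epsilon> f f' n)
          = measure_pmf.prob (G n) (Omega \<epsilon> f f' n)"
        using measure_pmf.prob_compl[of "Omega \<epsilon> f f' n" "G n"] by (simp add: Compl_eq_Diff_UNIV)
      also have "\<dots> \<le> measure_pmf.prob (G n) {g. spearman_rho n g > \<rho>}"
        using * by (intro measure_pmf.finite_measure_mono_AE) (auto simp: AE_measure_pmf_iff)
      finally show ?case .
    qed
  qed
  have "\<exists>h\<in>O(\<lambda>n. real n powr (-1 + min \<epsilon> (1 / 2)) + real n powr (-\<epsilon> + 3 * min \<epsilon> (1 / 2) / 4)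
                    + measure_pmf.prob (G n) (- Omega \<epsilon> f f' n)).
         \<forall>\<^sub>F n in sequentially. measure_pmf.prob (G n) {g. spearman_rho n g > \<rho>} \<ge> 1 - h n"
    if "0 < \<epsilon>" "G \<in> graph_class \<eta> \<epsilon> f f'" for \<eta> \<epsilon> G
    \<comment> \<open>The witness \<open>h\<close> is the probability of the complement of
      \<open>Omega\<close>, one of three nonnegative summands in the rate and hence dominated by
      it.\<close>
    using main[OF that]
    by (intro bexI[of _ "\<lambda>n. measure_pmf.prob (G n) (- Omega \<epsilon> f f' n)"])
      (auto intro!: landau_o.big_mono always_eventually)
  then show ?thesis
    \<comment> \<open>The slowly varying factor is the constant \<open>c\<close>.\<close>
    using f_int \<mu>(1) f' slowly_varying_const[OF c(1)] f_tail unfolding Let_def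
    by (intro exI[of _ f] exI[of _ f'] exI[of _ \<mu>] exI[of _ "\<lambda>_. c"]) (auto simp: \<mu>_def)
qed

end
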